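(* Let $(c_i)_{i\in\mathbb{Z}}$ be independent commuting formal variables and fix $\alpha\in\mathbb{Z}$. For $k\ge 0$ let $$p_k^{(\alpha)}(z)=\frac{1}{\tau_k^{(\alpha)}}\,z^k\,S^{+}(z)\tau_k^{(\alpha)},$$ and for polynomials $f,g$ in $z$ let $$\langle f(z),g(z)\rangle=\operatorname{Res}_z\Bigl(\sum_{i=0}^{\infty}\frac{c_{\alpha+i}}{z^{i+1}}\,f(z)g(z)\Bigr).$$ Then each $p_k^{(\alpha)}(z)$ is a monic polynomial in $z$ of degree $k$, and $$\langle p_k^{(\alpha)}(z),z^n\rangle=0\quad\text{for all } 0\le n<k .$$ Consequently $\langle p_k^{(\alpha)}(z),p_\ell^{(\alpha)}(z)\rangle=0$ for all $k,\ell\ge 0$ with $k\neq\ell$; that is, $\{p_k^{(\alpha)}\}_{k\ge0}$ is a collection of orthogonal polynomials for $\langle\,,\,\rangle$.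
   Context: Let $K=\mathbb{C}(c_i : i\in\mathbb{Z})$ be the field of rational functions in the formal variables $c_i$; polynomials in $z$ have coefficients in $K$. $\operatorname{Res}_z$ denotes the coefficient of $z^{-1}$. The $\widehat{GL_2}$ tau-functions are $\tau_0^{(\alpha)}=1$ and, for $k>0$, the Hankel determinants $\tau_k^{(\alpha)}=\det[c_{\alpha+i+j}]_{0\le i,j\le k-1}\in\mathbb{C}[c_i]_{i\in\mathbb{Z}}$. (They arise as matrix elements of an element of $\widehat{GL_2}$ on two-component fermionic Fock space; the determinant formula may be taken as the definition.) They are nonzero since the $c_i$ are independent formal variables. The positive shift field $S^{+}(z)=1-\frac{S}{z}$, where $S$ sends $c_k$ to $c_{k+1}$, acts multiplicatively: it is the $\mathbb{C}$-algebra homomorphism $S^{+}(z):\mathbb{C}[c_i]_{i\in\mathbb{Z}}\to\mathbb{C}[c_i]_{i\in\mathbb{Z}}[z^{-1}]$ determined by $S^{+}(z)c_k=c_k-c_{k+1}/z$ for all $k\in\mathbb{Z}$. *)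

theory Defs
  imports
    "HOL-Library.Poly_Mapping"
    "HOL-Computational_Algebra.Fraction_Field"
    "HOL-Computational_Algebra.Formal_Laurent_Series"
    "Jordan_Normal_Form.Determinant"
begin

(* C[c_i : i in Z], with monomials given by finitely supported exponent functions,
   and its fraction field K *)
type_synonym cpoly = "(int \<Rightarrow>\<^sub>0 nat) \<Rightarrow>\<^sub>0 complex"
type_synonym cfield = "cpoly fract"

definition cvar :: "int \<Rightarrow> cpoly" where
  "cvar i = Poly_Mapping.single (Poly_Mapping.single i 1) 1"

definition cconst :: "complex \<Rightarrow> cpoly" where
  "cconst a = Poly_Mapping.single 0 a"

definition to_cfield :: "cpoly \<Rightarrow> cfield" where
  "to_cfield p = Fract p 1"

definition tau :: "int \<Rightarrow> nat \<Rightarrow> cpoly" where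
  "tau \<alpha> k = det (mat k k (\<lambda>(i, j). cvar (\<alpha> + int i + int j)))"

lemma tau_0: "tau \<alpha> 0 = 1"
  by (simp add: tau_def)

(* Codomain C[c_i][1/z]: the indeterminate of the outer polynomial type is 1/z.
   That this substitution is the C-algebra homomorphism with c_k |-> c_k - c_(k+1)/z
   is proved in the lemmas shift_pos_* below. *)
definition shift_pos :: "cpoly \<Rightarrow> cpoly poly" where
  "shift_pos p = (\<Sum>m\<in>Poly_Mapping.keys p. [:cconst (Poly_Mapping.lookup p m):] *
     (\<Prod>k\<in>Poly_Mapping.keys m. [:cvar k, - cvar (k + 1):] ^ Poly_Mapping.lookup m k))"

(* Everything is compared inside the field K((1/z)) of formal Laurent series in 1/z:
   there fls_X is 1/z, fls_X_inv is z, and the coefficient of z^(-1) has index +1. *)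

definition embed_z :: "cfield poly \<Rightarrow> cfield fls" where
  "embed_z f = poly (map_poly fls_const f) fls_X_inv"

definition embed_zinv :: "cpoly poly \<Rightarrow> cfield fls" where
  "embed_zinv q = poly (map_poly (\<lambda>a. fls_const (to_cfield a)) q) fls_X"

definition Res_z :: "cfield fls \<Rightarrow> cfield" where
  "Res_z F = fls_nth F 1"

definition p_laurent :: "int \<Rightarrow> nat \<Rightarrow> cfield fls" where
  "p_laurent \<alpha> k =
     fls_const (1 / to_cfield (tau \<alpha> k)) * fls_X_inv ^ k * embed_zinv (shift_pos (tau \<alpha> k))"

(* the series with coefficient c_(alpha+i) at z^(-(i+1)), i >= 0 *)
definition moment_series :: "int \<Rightarrow> cfield fls" where
  "moment_series \<alpha> = fls_X * fps_to_fls (Abs_fps (\<lambda>i. to_cfield (cvar (\<alpha> + int i))))"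

definition pairing :: "int \<Rightarrow> cfield poly \<Rightarrow> cfield poly \<Rightarrow> cfield" where
  "pairing \<alpha> f g = Res_z (moment_series \<alpha> * embed_z (f * g))"

lemma embed_z_altdef:
  "embed_z f = (\<Sum>i\<le>degree f. fls_const (coeff f i) * fls_X_inv ^ i)"
proof -
  have "degree (map_poly fls_const f :: cfield fls poly) = degree f"
    by (rule degree_map_poly) (simp add: fls_const_nonzero)
  thus ?thesis
    by (simp add: embed_z_def poly_altdef coeff_map_poly)
qed

lemma embed_z_nth: "fls_nth (embed_z f) (- int n) = coeff f n"
proof -
  have "fls_nth (embed_z f) (- int n) = (\<Sum>i\<le>degree f. if i = n then coeff f i else 0)"
    unfolding embed_z_altdef fls_nth_sum
    by (intro sum.cong refl) simp
  thus ?thesis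
    by (simp add: coeff_eq_0)
qed

lemma inj_embed_z: "inj embed_z"
  by (intro injI poly_eqI) (metis embed_z_nth)

lemma moment_series_nth:
  "fls_nth (moment_series \<alpha>) n = (if n \<ge> 1 then to_cfield (cvar (\<alpha> + (n - 1))) else 0)"
  by (auto simp: moment_series_def fls_X_times_conv_shift)

lemma shift_pos_superset:
  assumes "finite A" "Poly_Mapping.keys p \<subseteq> A"
  shows "shift_pos p = (\<Sum>m\<in>A. [:cconst (Poly_Mapping.lookup p m):] *
     (\<Prod>k\<in>Poly_Mapping.keys m. [:cvar k, - cvar (k + 1):] ^ Poly_Mapping.lookup m k))"
  unfolding shift_pos_def
  by (rule sum.mono_neutral_left) (use assms in \<open>auto simp: in_keys_iff cconst_def\<close>)

lemma shift_pos_single: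
  "shift_pos (Poly_Mapping.single m a) = [:cconst a:] *
     (\<Prod>k\<in>Poly_Mapping.keys m. [:cvar k, - cvar (k + 1):] ^ Poly_Mapping.lookup m k)"
  by (subst shift_pos_superset[of "{m}"]) auto

lemma shift_pos_add: "shift_pos (p + q) = shift_pos p + shift_pos q"
proof -
  let ?A = "Poly_Mapping.keys p \<union> Poly_Mapping.keys q"
  have "Poly_Mapping.keys (p + q) \<subseteq> ?A"
    by (rule Poly_Mapping.keys_add)
  thus ?thesis
    by (simp add: shift_pos_superset[of ?A] sum.distrib[symmetric] lookup_add cconst_def
        single_add smult_add_left)
qed

lemma shift_pos_0: "shift_pos 0 = 0"
  by (simp add: shift_pos_def)

lemma shift_pos_sum: "shift_pos (sum f A) = (\<Sum>x\<in>A. shift_pos (f x))"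
  by (induction A rule: infinite_finite_induct) (auto simp: shift_pos_0 shift_pos_add)

lemma shift_pos_cconst: "shift_pos (cconst a) = [:cconst a:]"
  by (simp add: cconst_def shift_pos_single)

lemma shift_pos_1: "shift_pos 1 = 1"
  using shift_pos_cconst[of 1] by (simp add: cconst_def)

lemma shift_pos_cvar: "shift_pos (cvar k) = [:cvar k, - cvar (k + 1):]"
  by (simp add: cvar_def shift_pos_single cconst_def)

lemma sum_singles: "(\<Sum>m\<in>Poly_Mapping.keys p. Poly_Mapping.single m (Poly_Mapping.lookup p m)) = p"
  by (rule poly_mapping_eqI)
    (auto simp: lookup_sum lookup_single when_def in_keys_iff sum.delta)

lemma shift_pos_mult_single:
  "shift_pos (Poly_Mapping.single m a * Poly_Mapping.single n b) =
   shift_pos (Poly_Mapping.single m a) * shift_pos (Poly_Mapping.single n b)"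
proof -
  let ?A = "Poly_Mapping.keys m \<union> Poly_Mapping.keys n"
  let ?v = "\<lambda>k. [:cvar k, - cvar (k + 1):]"
  have *: "(\<Prod>k\<in>Poly_Mapping.keys l. ?v k ^ Poly_Mapping.lookup l k) =
           (\<Prod>k\<in>?A. ?v k ^ Poly_Mapping.lookup l k)"
    if "Poly_Mapping.keys l \<subseteq> ?A" for l
    by (rule prod.mono_neutral_left) (use that in \<open>auto simp: in_keys_iff\<close>)
  have "Poly_Mapping.keys (m + n) \<subseteq> ?A"
    by (rule Poly_Mapping.keys_add)
  hence "(\<Prod>k\<in>Poly_Mapping.keys (m + n). ?v k ^ Poly_Mapping.lookup (m + n) k) =
    (\<Prod>k\<in>Poly_Mapping.keys m. ?v k ^ Poly_Mapping.lookup m k) *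
    (\<Prod>k\<in>Poly_Mapping.keys n. ?v k ^ Poly_Mapping.lookup n k)"
    by (simp only: * [OF Un_upper1] * [OF Un_upper2] *) (simp add: lookup_add power_add prod.distrib)
  moreover have "[:cconst (a * b):] = [:cconst a:] * [:cconst b:]"
    by (simp add: cconst_def mult_single mult.commute)
  ultimately show ?thesis
    unfolding mult_single shift_pos_single by (simp only: mult_ac)
qed

lemma shift_pos_mult: "shift_pos (p * q) = shift_pos p * shift_pos q"
proof -
  let ?s = "\<lambda>p m. Poly_Mapping.single m (Poly_Mapping.lookup p m)"
  have "p * q = (\<Sum>m\<in>Poly_Mapping.keys p. \<Sum>n\<in>Poly_Mapping.keys q. ?s p m * ?s q n)"
    by (simp only: sum_product[symmetric] sum_singles)
  hence "shift_pos (p * q) = (\<Sum>m\<in>Poly_Mapping.keys p. shift_pos (?s p m)) *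
      (\<Sum>n\<in>Poly_Mapping.keys q. shift_pos (?s q n))"
    by (simp only: shift_pos_sum shift_pos_mult_single sum_product)
  thus ?thesis
    by (simp only: shift_pos_sum[symmetric] sum_singles)
qed

end

theory Submission
  imports Defs "Jordan_Normal_Form.Char_Poly"
begin

text \<open>
  Write \<open>c\<^sub>i\<close> for the moment with index \<open>\<alpha> + i\<close>, let \<open>H = [c\<^sub>i\<^sub>+\<^sub>j]\<close> be the \<open>k \<times> k\<close> Hankel matrix,
  and let \<open>H' = [c\<^sub>i\<^sub>+\<^sub>j\<^sub>+\<^sub>1]\<close> be its shift.  Since the shift field is a ring homomorphism, it can
  be applied entrywise inside the determinant, and so \<open>z\<^sup>k S\<^sup>+(z) \<tau>\<^sub>k = det (z H - H')\<close>.

  The point is that this pencil determinant equals the classical determinant of the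
  \<open>(k+1) \<times> (k+1)\<close> matrix whose first \<open>k\<close> rows are \<open>(c\<^sub>i, \<dots>, c\<^sub>i\<^sub>+\<^sub>k)\<close> and whose last row is
  \<open>(1, z, \<dots>, z\<^sup>k)\<close> (lemma \<open>det_hankel_pencil\<close>).  Expanding along the last row, the
  coefficient of \<open>z\<^sup>j\<close> is the cofactor at position \<open>(k, j)\<close>, which does not depend on the last row.
  The top coefficient is \<open>det H = \<tau>\<^sub>k\<close> (\<open>border_cofactor_corner\<close>), so division by \<open>\<tau>\<^sub>k\<close> makes
  the polynomial monic.  Pairing with \<open>z\<^sup>n\<close> replaces each \<open>z\<^sup>j\<close> in the last row by
  \<open>c\<^sub>n\<^sub>+\<^sub>j\<close>; for \<open>n < k\<close> the resulting matrix has two equal rows, so its determinant vanishes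
  (\<open>border_cofactor_orthogonal\<close>).  Orthogonality of \<open>p\<^sub>k\<close> and \<open>p\<^sub>l\<close> follows by linearity
  and symmetry of the pairing.

  The division is legitimate because \<open>\<tau>\<^sub>k \<noteq> 0\<close> (\<open>tau_nonzero\<close>): the monomial
  \<open>c\<^sub>k\<^sub>-\<^sub>1\<^sup>k\<close> arises in the Leibniz expansion from the antidiagonal permutation only.
\<close>

section \<open>Bordered Hankel determinants over a commutative ring\<close>

text \<open>The \<open>k \<times> k\<close> Hankel matrix of the sequence \<open>c\<close>, with rows and columns counted from 0.\<close>

definition hankel :: "(nat \<Rightarrow> 'a) \<Rightarrow> nat \<Rightarrow> 'a mat" where
  "hankel c k = mat k k (\<lambda>(i, j). c (i + j))"

text \<open>
  The first \<open>k\<close> rows of the Hankel matrix of size \<open>k + 1\<close>, completed by an arbitrary last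
  row \<open>r\<close>.
\<close>

definition bordered_hankel :: "(nat \<Rightarrow> 'a) \<Rightarrow> (nat \<Rightarrow> 'a) \<Rightarrow> nat \<Rightarrow> 'a mat" where
  "bordered_hankel c r k = mat (Suc k) (Suc k) (\<lambda>(i, j). if i < k then c (i + j) else r j)"

text \<open>
  The cofactor of the \<open>j\<close>-th entry of the last row.  It does not depend on that row, which is
  therefore filled with zeros here.
\<close>

definition border_cofactor :: "(nat \<Rightarrow> 'a::comm_ring_1) \<Rightarrow> nat \<Rightarrow> nat \<Rightarrow> 'a" where
  "border_cofactor c k j = cofactor (bordered_hankel c (\<lambda>_. 0) k) k j"

lemma bordered_hankel_carrier: "bordered_hankel c r k \<in> carrier_mat (Suc k) (Suc k)"
  by (simp add: bordered_hankel_def)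

lemma cofactor_bordered_hankel:
  assumes "j \<le> k"
  shows "cofactor (bordered_hankel c r k) k j = border_cofactor c k j"
proof -
  have "mat_delete (bordered_hankel c r k) k j = mat_delete (bordered_hankel c (\<lambda>_. 0) k) k j"
    using assms by (intro eq_matI) (auto simp: mat_delete_def bordered_hankel_def)
  thus ?thesis
    by (simp add: border_cofactor_def cofactor_def)
qed

lemma det_bordered_hankel:
  "det (bordered_hankel c r k) = (\<Sum>j\<le>k. r j * border_cofactor c k j)"
proof -
  have "det (bordered_hankel c r k) = (\<Sum>j<Suc k. bordered_hankel c r k $$ (k, j) *
      cofactor (bordered_hankel c r k) k j)"
    by (rule laplace_expansion_row[OF bordered_hankel_carrier]) simp
  also have "\<dots> = (\<Sum>j<Suc k. r j * border_cofactor c k j)"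
    by (intro sum.cong refl) (simp add: cofactor_bordered_hankel, simp add: bordered_hankel_def)
  finally show ?thesis
    by (simp only: lessThan_Suc_atMost)
qed

lemma border_cofactor_corner: "border_cofactor c k k = det (hankel c k)"
proof -
  have "mat_delete (bordered_hankel c (\<lambda>_. 0) k) k k = hankel c k"
    by (rule eq_matI) (auto simp: mat_delete_def bordered_hankel_def hankel_def)
  thus ?thesis
    by (simp add: border_cofactor_def cofactor_def)
qed

lemma border_cofactor_orthogonal:
  assumes "n < k"
  shows "(\<Sum>j\<le>k. c (n + j) * border_cofactor c k j) = 0"
proof -
  let ?M = "bordered_hankel c (\<lambda>j. c (n + j)) k"
  have "Matrix.row ?M n = Matrix.row ?M k"
    using assms by (intro eq_vecI) (auto simp: bordered_hankel_def)
  hence "det ?M = 0"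
    using assms by (intro det_identical_rows[OF bordered_hankel_carrier, of n k]) auto
  thus ?thesis
    by (simp add: det_bordered_hankel)
qed

lemma (in comm_ring_hom) hom_border_cofactor:
  "border_cofactor (\<lambda>i. hom (c i)) k j = hom (border_cofactor c k j)"
proof -
  have "mat_delete (bordered_hankel (\<lambda>i. hom (c i)) (\<lambda>_. 0) k) k j =
        map_mat hom (mat_delete (bordered_hankel c (\<lambda>_. 0) k) k j)"
    by (rule eq_matI) (auto simp: mat_delete_def bordered_hankel_def)
  thus ?thesis
    by (simp add: border_cofactor_def cofactor_def hom_distribs)
qed

text \<open>
  Multiplying the matrix bordered by the powers of \<open>z\<close> from the right by the lower bidiagonal
  matrix with diagonal \<open>z\<close> and subdiagonal \<open>-1\<close> replaces each column but the last by \<open>z\<close> times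
  itself minus its right neighbour.  This clears the last row up to its corner \<open>z\<^sup>k\<^sup>+\<^sup>1\<close> and
  leaves the pencil in the upper left block.  As the bidiagonal matrix has determinant
  \<open>z\<^sup>k\<^sup>+\<^sup>1\<close>, this factor can be cancelled.
\<close>

lemma det_hankel_pencil:
  fixes c :: "nat \<Rightarrow> 'a::idom"
  assumes "z \<noteq> 0"
  shows "det (mat k k (\<lambda>(i, j). z * c (i + j) - c (Suc (i + j)))) =
         (\<Sum>j\<le>k. z ^ j * border_cofactor c k j)"
proof -
  let ?M = "bordered_hankel c (\<lambda>j. z ^ j) k"
  define U where "U = mat (Suc k) (Suc k)
    (\<lambda>(i, j). if i = j then z else if i = Suc j then - 1 else 0)"
  define W where "W = ?M * U"
  have U: "U \<in> carrier_mat (Suc k) (Suc k)"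
    by (simp add: U_def)
  have W: "W \<in> carrier_mat (Suc k) (Suc k)"
    unfolding W_def by (rule mult_carrier_mat[OF bordered_hankel_carrier U])
  have "det U = prod_list (diag_mat U)"
    by (rule det_lower_triangular[OF _ U]) (auto simp: U_def)
  also have "\<dots> = z ^ Suc k"
    using U by (simp add: prod_list_diag_prod) (simp add: U_def)
  finally have detU: "det U = z ^ Suc k" .
  have W_nth: "W $$ (i, j) = ?M $$ (i, j) * z - (if j < k then ?M $$ (i, Suc j) else 0)"
    if "i \<le> k" "j \<le> k" for i j
  proof -
    have "W $$ (i, j) = (\<Sum>l<Suc k. ?M $$ (i, l) * U $$ (l, j))"
      using that U bordered_hankel_carrier[of c "\<lambda>j. z ^ j" k]
      by (simp add: W_def scalar_prod_def atLeast0LessThan del: sum.lessThan_Suc)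
    also have "\<dots> = (\<Sum>l<Suc k. (if l = j then ?M $$ (i, l) * z else 0) -
        (if l = Suc j then ?M $$ (i, l) else 0))"
      using that by (intro sum.cong refl) (auto simp: U_def)
    also have "\<dots> = ?M $$ (i, j) * z - (if j < k then ?M $$ (i, Suc j) else 0)"
      unfolding sum_subtractf using that by (simp add: sum.delta del: sum.lessThan_Suc)
    finally show ?thesis .
  qed
  have W_last: "W $$ (k, j) = (if j = k then z ^ Suc k else 0)" if "j \<le> k" for j
    using that by (auto simp: W_nth) (auto simp: bordered_hankel_def)
  have "mat_delete W k k = mat k k (\<lambda>(i, j). z * c (i + j) - c (Suc (i + j)))" (is "_ = ?P")
    using W by (intro eq_matI)
      (auto simp: mat_delete_def W_nth, auto simp: bordered_hankel_def)
  hence cof: "cofactor W k k = det ?P"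
    by (simp add: cofactor_def)
  have "det W = (\<Sum>j<Suc k. W $$ (k, j) * cofactor W k j)"
    by (rule laplace_expansion_row[OF W]) simp
  also have "\<dots> = (\<Sum>j<Suc k. if j = k then z ^ Suc k * cofactor W k k else 0)"
    by (intro sum.cong refl) (auto simp: W_last)
  also have "\<dots> = z ^ Suc k * det ?P"
    by (simp add: cof)
  finally have "det ?M * z ^ Suc k = z ^ Suc k * det ?P"
    by (simp add: W_def det_mult[OF bordered_hankel_carrier U] detU)
  thus ?thesis
    using assms by (simp add: det_bordered_hankel)
qed

section \<open>The tau-functions are nonzero\<close>

lemma prod_single_one:
  "(\<Prod>i\<in>A. Poly_Mapping.single (f i) (1::'b::comm_semiring_1)) =
   Poly_Mapping.single (\<Sum>i\<in>A. f i) 1"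
  by (induction A rule: infinite_finite_induct) (auto simp: mult_single)

lemma lookup_signof_mult:
  "Poly_Mapping.lookup (signof p * (q :: cpoly)) m = signof p * Poly_Mapping.lookup q m"
  by (simp add: sign_def)

text \<open>
  The coefficient of \<open>m\<close>, the \<open>k\<close>-th power of the antidiagonal variable, is the sign of the
  order-reversing permutation \<open>r\<close>.
\<close>

lemma tau_nonzero: "tau \<alpha> k \<noteq> 0"
proof -
  define m where "m = Poly_Mapping.single (\<alpha> + int k - 1) k"
  define r where "r = (\<lambda>i. if i < k then k - 1 - i else i)"
  let ?S = "{p. p permutes {0..<k}}"
  let ?e = "\<lambda>p. \<Sum>i = 0..<k. Poly_Mapping.single (\<alpha> + int i + int (p i)) (1::nat)"
  have r: "r permutes {0..<k}"
  proof (rule bij_imp_permutes)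
    show "bij_betw r {0..<k} {0..<k}"
      by (rule bij_betw_byWitness[of _ r]) (auto simp: r_def)
  qed (simp add: r_def)
  have e_iff: "?e p = m \<longleftrightarrow> p = r" if p: "p permutes {0..<k}" for p
  proof
    assume eq: "?e p = m"
    show "p = r"
    proof
      fix i
      show "p i = r i"
      proof (cases "i < k")
        case True
        let ?s = "\<alpha> + int i + int (p i)"
        \<comment> \<open>The variable picked in row \<open>i\<close> divides the monomial, so it is the antidiagonal one.\<close>
        have "1 \<le> Poly_Mapping.lookup (?e p) ?s"
          unfolding lookup_sum using True
          by (intro order.trans[OF _ member_le_sum[of i]]) auto
        hence "?s = \<alpha> + int k - 1"
          unfolding eq m_def by (auto simp: lookup_single when_def split: if_splits)
        thus ?thesis
          using True by (simp add: r_def)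
      next
        case False
        thus ?thesis
          using permutes_not_in[OF p, of i] by (simp add: r_def)
      qed
    qed
  next
    assume "p = r"
    have "?e r = (\<Sum>i = 0..<k. Poly_Mapping.single (\<alpha> + int k - 1) 1)"
      by (intro sum.cong refl) (auto simp: r_def algebra_simps)
    also have "\<dots> = m"
      unfolding m_def
      by (rule poly_mapping_eqI) (simp only: lookup_sum lookup_single, simp add: when_def)
    finally show "?e p = m"
      using \<open>p = r\<close> by simp
  qed
  have "tau \<alpha> k = (\<Sum>p\<in>?S. signof p * Poly_Mapping.single (?e p) 1)"
    unfolding tau_def det_def'[OF mat_carrier]
  proof (intro sum.cong refl arg_cong2[where f = "(*)"])
    fix p assume "p \<in> ?S"
    hence p: "p permutes {0..<k}" by simp
    have "(\<Prod>i = 0..<k. mat k k (\<lambda>(i, j). cvar (\<alpha> + int i + int j)) $$ (i, p i)) =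
      (\<Prod>i = 0..<k. cvar (\<alpha> + int i + int (p i)))"
      using permutes_in_image[OF p] by (intro prod.cong refl) simp
    thus "(\<Prod>i = 0..<k. mat k k (\<lambda>(i, j). cvar (\<alpha> + int i + int j)) $$ (i, p i)) =
      Poly_Mapping.single (?e p) 1"
      by (simp only: cvar_def prod_single_one)
  qed
  hence "Poly_Mapping.lookup (tau \<alpha> k) m =
      (\<Sum>p\<in>?S. signof p * (1 when ?e p = m))"
    by (simp only: lookup_sum[of _ ?S] lookup_signof_mult lookup_single)
  also have "\<dots> = (\<Sum>p\<in>?S. if p = r then signof r else 0)"
    by (intro sum.cong refl, simp only: mem_Collect_eq e_iff) (simp add: when_def)
  also have "\<dots> = signof r"
    using r by (simp add: finite_permutations)
  finally show ?thesis
    by (auto simp: sign_def split: if_splits)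
qed

section \<open>The embeddings into Laurent series\<close>

lemma comm_ring_hom_to_cfield: "comm_ring_hom to_cfield"
  by unfold_locales (auto simp: to_cfield_def Zero_fract_def One_fract_def)

lemma to_cfield_eq_0_iff: "to_cfield p = 0 \<longleftrightarrow> p = 0"
  by (simp add: to_cfield_def Zero_fract_def eq_fract)

lemma comm_ring_hom_fls_const: "comm_ring_hom (fls_const :: 'a::comm_ring_1 \<Rightarrow> 'a fls)"
  by unfold_locales (auto simp: fls_const_mult_const fls_plus_const)

lemma comm_ring_hom_const_to_cfield: "comm_ring_hom (\<lambda>a. fls_const (to_cfield a))"
proof -
  interpret c: comm_ring_hom "fls_const :: cfield \<Rightarrow> cfield fls"
    by (rule comm_ring_hom_fls_const)
  interpret t: comm_ring_hom to_cfield
    by (rule comm_ring_hom_to_cfield)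
  show ?thesis
    by unfold_locales (simp_all only: c.hom_add c.hom_mult c.hom_zero c.hom_one
        t.hom_add t.hom_mult t.hom_zero t.hom_one)
qed

lemma comm_ring_hom_poly_map_poly:
  assumes "comm_ring_hom h"
  shows "comm_ring_hom (\<lambda>p. poly (map_poly h p) x)"
proof -
  interpret h: comm_ring_hom h
    by (rule assms)
  interpret m: map_poly_comm_ring_hom h ..
  show ?thesis
    by unfold_locales (simp_all only: m.hom_add m.hom_mult m.hom_zero m.hom_one
        poly_add poly_mult poly_0 poly_1)
qed

lemma comm_ring_hom_embed_z: "comm_ring_hom embed_z"
  unfolding embed_z_def
  by (rule comm_ring_hom_poly_map_poly[OF comm_ring_hom_fls_const])

text \<open>The shift field, composed with the inclusion of its codomain into the Laurent series.\<close>

lemma comm_ring_hom_embed_shift: "comm_ring_hom (\<lambda>p. embed_zinv (shift_pos p))"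
proof -
  interpret e: comm_ring_hom embed_zinv
    unfolding embed_zinv_def
    by (rule comm_ring_hom_poly_map_poly[OF comm_ring_hom_const_to_cfield])
  show ?thesis
    by unfold_locales (simp_all only: shift_pos_0 shift_pos_1 shift_pos_add shift_pos_mult
        e.hom_add e.hom_mult e.hom_zero e.hom_one)
qed

lemma embed_z_monom: "embed_z (monom a n) = fls_const a * fls_X_inv ^ n"
  by (simp add: embed_z_def map_poly_monom poly_monom)

text \<open>
  The entries of \<open>z H - H'\<close>: distributing one factor \<open>z\<close> to each row of the Hankel matrix
  accounts for the factor \<open>z\<^sup>k\<close> in front of the shifted tau-function.
\<close>

lemma embed_shift_cvar:
  "fls_X_inv * embed_zinv (shift_pos (cvar i)) =
   fls_X_inv * fls_const (to_cfield (cvar i)) - fls_const (to_cfield (cvar (i + 1)))"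
proof -
  interpret h: comm_ring_hom "\<lambda>a. fls_const (to_cfield a)"
    by (rule comm_ring_hom_const_to_cfield)
  have "embed_zinv (shift_pos (cvar i)) =
    fls_const (to_cfield (cvar i)) - fls_X * fls_const (to_cfield (cvar (i + 1)))"
    unfolding shift_pos_cvar embed_zinv_def
    by (simp only: h.map_poly_pCons_hom h.hom_uminus map_poly_0 poly_pCons poly_0 mult_zero_right
        add_0_right) simp
  moreover have "fls_X_inv * (fls_X * x) = x" for x :: "cfield fls"
    by (simp add: fls_X_times_conv_shift fls_X_inv_times_conv_shift)
  ultimately show ?thesis
    by (simp only: right_diff_distrib)
qed

section \<open>The pairing in terms of moments\<close>

text \<open>The \<open>i\<close>-th moment: the value of the pairing on two monomials of total degree \<open>i\<close>.\<close>

abbreviation moment :: "int \<Rightarrow> nat \<Rightarrow> cfield" where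
  "moment \<alpha> i \<equiv> to_cfield (cvar (\<alpha> + int i))"

lemma pairing_commute: "pairing \<alpha> f g = pairing \<alpha> g f"
  by (simp add: pairing_def mult.commute)

lemma pairing_sum_left: "pairing \<alpha> (\<Sum>i\<in>A. f i) g = (\<Sum>i\<in>A. pairing \<alpha> (f i) g)"
proof -
  interpret comm_ring_hom embed_z
    by (rule comm_ring_hom_embed_z)
  show ?thesis
    by (simp add: pairing_def Res_z_def sum_distrib_right sum_distrib_left hom_sum fls_nth_sum)
qed

lemma pairing_monom: "pairing \<alpha> (monom a i) (monom b j) = a * b * moment \<alpha> (i + j)"
proof -
  have "pairing \<alpha> (monom a i) (monom b j) =
    fls_nth (fls_const (a * b) * (moment_series \<alpha> * fls_X_inv ^ (i + j))) 1"
    by (simp add: pairing_def Res_z_def mult_monom embed_z_monom mult_ac)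
  thus ?thesis
    by (simp add: fls_X_inv_power_times_conv_shift moment_series_nth)
qed

lemma pairing_monom_right:
  assumes "degree f \<le> N"
  shows "pairing \<alpha> f (monom b n) = (\<Sum>i\<le>N. coeff f i * b * moment \<alpha> (n + i))"
proof -
  have "f = (\<Sum>i\<le>N. monom (coeff f i) i)"
    using assms by (simp add: poly_as_sum_of_monoms')
  hence "pairing \<alpha> f (monom b n) = (\<Sum>i\<le>N. pairing \<alpha> (monom (coeff f i) i) (monom b n))"
    by (metis pairing_sum_left)
  thus ?thesis
    by (simp add: pairing_monom add.commute)
qed

lemma pairing_lower_degree_eq_0:
  assumes orth: "\<And>n. n < k \<Longrightarrow> pairing \<alpha> f (monom 1 n) = 0" and deg: "degree g < k"
  shows "pairing \<alpha> f g = 0"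
proof -
  have "pairing \<alpha> (monom b n) f = 0" if "n < k" for b n
  proof -
    have "pairing \<alpha> f (monom b n) = b * pairing \<alpha> f (monom 1 n)"
      by (simp add: pairing_monom_right[OF order.refl] sum_distrib_left mult_ac)
    also have "\<dots> = 0"
      by (simp add: orth[OF that])
    finally show ?thesis
      by (subst pairing_commute)
  qed
  hence "pairing \<alpha> (\<Sum>n\<le>degree g. monom (coeff g n) n) f = 0"
    unfolding pairing_sum_left using deg by (intro sum.neutral) auto
  thus ?thesis
    unfolding poly_as_sum_of_monoms by (subst pairing_commute)
qed

section \<open>The orthogonal polynomials\<close>

text \<open>
  The polynomial \<open>p\<^sub>k\<close>, given by its coefficients: the cofactors of the last row
  \<open>(1, z, \<dots>, z\<^sup>k)\<close>, divided by the tau-function.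
\<close>

definition hankel_poly :: "int \<Rightarrow> nat \<Rightarrow> cfield poly" where
  "hankel_poly \<alpha> k = (\<Sum>j\<le>k. monom (border_cofactor (moment \<alpha>) k j / to_cfield (tau \<alpha> k)) j)"

lemma coeff_hankel_poly:
  "coeff (hankel_poly \<alpha> k) j =
   (if j \<le> k then border_cofactor (moment \<alpha>) k j / to_cfield (tau \<alpha> k) else 0)"
  by (simp add: hankel_poly_def coeff_sum)

lemma to_cfield_tau: "to_cfield (tau \<alpha> k) = det (hankel (moment \<alpha>) k)"
proof -
  interpret comm_ring_hom to_cfield
    by (rule comm_ring_hom_to_cfield)
  have "hankel (moment \<alpha>) k = map_mat to_cfield (mat k k (\<lambda>(i, j). cvar (\<alpha> + int i + int j)))"
    by (rule eq_matI) (auto simp: hankel_def add.assoc)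
  thus ?thesis
    by (simp add: tau_def)
qed

lemma hankel_poly_monic: "degree (hankel_poly \<alpha> k) = k" "lead_coeff (hankel_poly \<alpha> k) = 1"
proof -
  have top: "coeff (hankel_poly \<alpha> k) k = 1"
    using tau_nonzero[of \<alpha> k]
    by (simp add: coeff_hankel_poly border_cofactor_corner flip: to_cfield_tau)
      (simp add: to_cfield_eq_0_iff)
  show deg: "degree (hankel_poly \<alpha> k) = k"
  proof (rule antisym)
    show "degree (hankel_poly \<alpha> k) \<le> k"
      by (rule degree_le) (simp add: coeff_hankel_poly)
    show "k \<le> degree (hankel_poly \<alpha> k)"
      by (rule le_degree) (simp add: top)
  qed
  show "lead_coeff (hankel_poly \<alpha> k) = 1"
    by (simp add: deg top)
qed

lemma hankel_poly_orthogonal: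
  assumes "n < k"
  shows "pairing \<alpha> (hankel_poly \<alpha> k) (monom 1 n) = 0"
proof -
  have "pairing \<alpha> (hankel_poly \<alpha> k) (monom 1 n) =
    (\<Sum>j\<le>k. moment \<alpha> (n + j) * border_cofactor (moment \<alpha>) k j) / to_cfield (tau \<alpha> k)"
    by (subst pairing_monom_right[of _ k])
      (auto simp: hankel_poly_monic coeff_hankel_poly sum_divide_distrib intro!: sum.cong)
  thus ?thesis
    using border_cofactor_orthogonal[OF assms, of "moment \<alpha>"] by simp
qed

lemma embed_hankel_poly: "embed_z (hankel_poly \<alpha> k) = p_laurent \<alpha> k"
proof -
  interpret c: comm_ring_hom "fls_const :: cfield \<Rightarrow> cfield fls"
    by (rule comm_ring_hom_fls_const)
  interpret e: comm_ring_hom embed_z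
    by (rule comm_ring_hom_embed_z)
  interpret s: comm_ring_hom "\<lambda>p. embed_zinv (shift_pos p)"
    by (rule comm_ring_hom_embed_shift)
  let ?\<tau> = "to_cfield (tau \<alpha> k)" and ?z = "fls_X_inv :: cfield fls"
  let ?T = "mat k k (\<lambda>(i, j). cvar (\<alpha> + int i + int j))"
  let ?c = "\<lambda>i. fls_const (moment \<alpha> i)"
  have "?z ^ k * embed_zinv (shift_pos (tau \<alpha> k)) =
    det (?z \<cdot>\<^sub>m map_mat (\<lambda>p. embed_zinv (shift_pos p)) ?T)"
    by (simp add: tau_def)
  also have "?z \<cdot>\<^sub>m map_mat (\<lambda>p. embed_zinv (shift_pos p)) ?T =
    mat k k (\<lambda>(i, j). ?z * ?c (i + j) - ?c (Suc (i + j)))"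
    by (rule eq_matI) (auto simp: embed_shift_cvar add_ac)
  also have "det \<dots> = (\<Sum>j\<le>k. ?z ^ j * border_cofactor ?c k j)"
    by (rule det_hankel_pencil) simp
  finally have det: "?z ^ k * embed_zinv (shift_pos (tau \<alpha> k)) =
    (\<Sum>j\<le>k. ?z ^ j * fls_const (border_cofactor (moment \<alpha>) k j))"
    by (simp only: c.hom_border_cofactor)
  have "embed_z (hankel_poly \<alpha> k) =
    (\<Sum>j\<le>k. fls_const (1 / ?\<tau> * border_cofactor (moment \<alpha>) k j) * ?z ^ j)"
    by (simp add: hankel_poly_def e.hom_sum embed_z_monom)
  also have "\<dots> = fls_const (1 / ?\<tau>) *
    (\<Sum>j\<le>k. ?z ^ j * fls_const (border_cofactor (moment \<alpha>) k j))"
    by (simp only: sum_distrib_left c.hom_mult mult_ac)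
  also have "\<dots> = p_laurent \<alpha> k"
    by (simp only: p_laurent_def det[symmetric] mult.assoc)
  finally show ?thesis .
qed

theorem mainTheorem2:
  fixes \<alpha> :: int
  shows "\<exists>P :: nat \<Rightarrow> cfield poly.
    (\<forall>k. embed_z (P k) = p_laurent \<alpha> k \<and> degree (P k) = k \<and> lead_coeff (P k) = 1) \<and>
    (\<forall>k n. n < k \<longrightarrow> pairing \<alpha> (P k) (monom 1 n) = 0) \<and>
    (\<forall>k l. k \<noteq> l \<longrightarrow> pairing \<alpha> (P k) (P l) = 0)"
proof -
  have less: "pairing \<alpha> (hankel_poly \<alpha> k) (hankel_poly \<alpha> l) = 0" if "l < k" for k l
    by (rule pairing_lower_degree_eq_0[of k]) (auto simp: that hankel_poly_orthogonal hankel_poly_monic)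
  have "pairing \<alpha> (hankel_poly \<alpha> k) (hankel_poly \<alpha> l) = 0" if "k \<noteq> l" for k l
    using that less[of k l] less[of l k] pairing_commute by (metis nat_neq_iff)
  thus ?thesis
    using embed_hankel_poly hankel_poly_monic hankel_poly_orthogonal by blast
qed

end
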